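(* Let $a,b,c,d,e,a',b',c',e'$ be complex parameters with $$a'=d-a,\qquad d+e-a-b-c=1,$$ and suppose that at least one of the following conditions holds: (i) $a$ is a negative integer and $\Re(d+e'-a'-b'-c')>0$; (ii) $c$ and $c'$ are negative integers. Then $$F_{1:1}^{0:3}\left[{-\atop d}:{a,b,c\atop e};{a',b',c'\atop e'};1,1\right]=\frac{\Gamma(e)\Gamma(e-a-b)\Gamma(e-a-c)\Gamma(e-b-c)\Gamma(e')\Gamma(e'-b'-c')}{\Gamma(e-a)\Gamma(e-b)\Gamma(e-c)\Gamma(e-a-b-c)\Gamma(e'-b')\Gamma(e'-c')}\;{}_4F_3\left[{a,\;b',\;c',\;d-b-c\atop d-b,\;d-c,\;1+b'+c'-e'};1\right].$$
   Context: $(x)_m=x(x+1)\cdots(x+m-1)$, $(x)_0=1$, is the Pochhammer symbol, and $(x_1,\dots,x_r)_m=(x_1)_m\cdots(x_r)_m$. The Kampé de Fériet series is $$F_{1:1}^{0:3}\left[{-\atop d}:{a,b,c\atop e};{a',b',c'\atop e'};x,y\right]=\sum_{m,n=0}^\infty\frac{(a,b,c)_m(a',b',c')_n}{(d)_{m+n}(e)_m(e')_n}\frac{x^my^n}{m!\,n!}.$$ It is absolutely convergent for $|x|=|y|=1$ when $\Re(d+e-a-b-c)>0$ and $\Re(d+e'-a'-b'-c')>0$. The generalized hypergeometric series is ${}_{p}F_{q}\left[{\alpha_1,\dots,\alpha_p\atop\beta_1,\dots,\beta_q};x\right]=\sum_{k\ge0}\frac{(\alpha_1,\dots,\alpha_p)_k}{(\beta_1,\dots,\beta_q)_k}\frac{x^k}{k!}$.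 It is understood throughout that no denominator parameter of any series occurring (the single or the double one) is zero or a negative integer. It is also understood that the right-hand side is well defined, i.e. that no Gamma function in the numerator of the prefactor is evaluated at zero or a negative integer; in the denominator, $1/\Gamma$ is taken to be $0$ at such points. *)

theory Defs
  imports "HOL-Analysis.Analysis"
begin

text \<open>The Kampe de Feriet series $F_{1:1}^{0:3}$. The primes of $a', b', c', e'$ are rendered
  as \<open>a2 b2 c2 e2\<close>.\<close>

definition kdf_term ::
  "complex \<Rightarrow> complex \<Rightarrow> complex \<Rightarrow> complex \<Rightarrow> complex \<Rightarrow> complex \<Rightarrow> complex \<Rightarrow> complex \<Rightarrow> complex \<Rightarrow>
   complex \<Rightarrow> complex \<Rightarrow> nat \<times> nat \<Rightarrow> complex" where
  "kdf_term d a b c e a2 b2 c2 e2 x y = (\<lambda>(m, n).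
     (pochhammer a m * pochhammer b m * pochhammer c m *
      (pochhammer a2 n * pochhammer b2 n * pochhammer c2 n)) /
     (pochhammer d (m + n) * pochhammer e m * pochhammer e2 n) *
     (x ^ m * y ^ n / (fact m * fact n)))"

text \<open>\<open>infsum\<close> is the unordered (for complex terms: absolutely convergent) sum; it is \<open>0\<close> by
  convention if the terms are not summable.\<close>

definition kdf ::
  "complex \<Rightarrow> complex \<Rightarrow> complex \<Rightarrow> complex \<Rightarrow> complex \<Rightarrow> complex \<Rightarrow> complex \<Rightarrow> complex \<Rightarrow> complex \<Rightarrow>
   complex \<Rightarrow> complex \<Rightarrow> complex" where
  "kdf d a b c e a2 b2 c2 e2 x y = infsum (kdf_term d a b c e a2 b2 c2 e2 x y) UNIV"

text \<open>The library's \<open>fps_hypergeo as bs 1\<close> is the formal series with coefficients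
  $(\alpha_1,\dots,\alpha_p)_k / ((\beta_1,\dots,\beta_q)_k\, k!)$.\<close>

definition hypergeo :: "complex list \<Rightarrow> complex list \<Rightarrow> complex \<Rightarrow> complex" where
  "hypergeo as bs x = eval_fps (fps_hypergeo as bs 1) x"

end

theory Submission
  imports Defs
begin

text \<open>
  In the double series, write \<open>u n\<close> for the factor $(b')_n(c')_n/((e')_n\,n!)$ and sum over \<open>m\<close> first.
  For fixed \<open>n\<close> the inner sum is $\frac{(d-a)_n}{(d)_n}\,{}_3F_2(a,b,c;d+n,e;1)$, a terminating series.
  The balancing condition $d+e-a-b-c=1$ is what allows it to be rewritten as
  \[ P\cdot{}_3F_2(a,-n,d-b-c;\,d-b,d-c;\,1), \]
  where \<open>P\<close> is the Saalschuetz value of the inner series at $n=0$, that is, the part of the Gamma prefactor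
  built from \<open>a, b, c, e\<close>. The index \<open>n\<close> now occurs only in the polynomials $(-n)_k$, and each
  $\sum_n u_n (-n)_k$ is a shifted Gauss series, with value
  \[ \frac{\Gamma(e')\Gamma(e'-b'-c')}{\Gamma(e'-b')\Gamma(e'-c')}\cdot\frac{(b')_k(c')_k}{(1+b'+c'-e')_k}. \]
  Summing over \<open>k\<close> yields the remaining Gamma factors and the ${}_4F_3$.

  The rewriting of the inner sum is \<open>row_sum_terminating_left\<close> if $a=-N$ and \<open>row_sum_terminating_right\<close>
  if $c=-M$. Both rest on Thomae's transformation \<open>cleared_3F2_Thomae\<close> of terminating ${}_3F_2$ series,
  a consequence of the Chu-Vandermonde sum. In the first case three applications suffice; in the second,
  the roles of \<open>M\<close> and \<open>n\<close> as terminating integers also have to be exchanged, which is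
  \<open>cleared_3F2_duality\<close>. The sum over \<open>n\<close> is \<open>Gauss_falling_has_sum\<close>. It rests on Gauss's theorem
  \<open>Gauss_summation\<close>, proved here by the contiguous relation in \<open>e\<close> and the limit $e\to\infty$.

  There are only finitely many nonzero rows (values of \<open>m\<close>), so absolute convergence of the double series
  and the interchange of summations reduce to convergence of each row. For $c'=-L$ the rows are finite. For
  $a=-N$ they are controlled by the hypothesis on real parts, which reads
  $\mathrm{Re}(e'-b'-c') > N$ and hence covers all orders $k\le N$ that occur.
\<close>

section \<open>Rising factorials and the Chu-Vandermonde sum\<close>

lemma pochhammer_reflect:
  fixes D :: "'a::comm_ring_1"
  assumes "k \<le> n"
  shows "pochhammer (1 - of_nat n - D) (n - k) = (-1) ^ (n - k) * pochhammer (D + of_nat k) (n - k)"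
  using pochhammer_minus[of "D + of_nat n - 1" "n - k"] assms
  by (simp add: algebra_simps of_nat_diff)

lemma pochhammer_split:
  "j \<le> n \<Longrightarrow> pochhammer x j * pochhammer (x + of_nat j) (n - j) = pochhammer x n"
  by (simp add: pochhammer_product[symmetric])

lemma pochhammer_shift_split:
  fixes x :: "'a::comm_ring_1"
  assumes "i \<le> j" "j \<le> n"
  shows "pochhammer (x + of_nat i) (j - i) * pochhammer (x + of_nat j) (n - j) =
         pochhammer (x + of_nat i) (n - i)"
  using pochhammer_product'[of "x + of_nat i" "j - i" "n - j"] assms
  by (simp add: of_nat_diff)

text \<open>This is the terminating Gauss sum ${}_2F_1(-n,A;D;1) = (D-A)_n/(D)_n$ multiplied by $(D)_n$, which
  makes it a polynomial identity, valid also where denominators would vanish. It is the binomial theorem for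
  rising factorials after the reflection $(1-n-D)_{n-k} = (-1)^{n-k}(D+k)_{n-k}$.\<close>

lemma Chu_Vandermonde:
  fixes A D :: "'a::comm_ring_1"
  shows "(\<Sum>k\<le>n. of_nat (n choose k) * (-1) ^ k * pochhammer A k * pochhammer (D + of_nat k) (n - k)) =
         pochhammer (D - A) n"
proof -
  have "pochhammer (D - A) n = (-1) ^ n * pochhammer (A + (1 - of_nat n - D)) n"
    using pochhammer_minus[of "A - D" n] by (simp add: algebra_simps)
  also have "\<dots> = (\<Sum>k\<le>n. of_nat (n choose k) * (-1) ^ k * pochhammer A k * pochhammer (D + of_nat k) (n - k))"
    unfolding pochhammer_binomial_sum[of A "1 - of_nat n - D"] sum_distrib_left
  proof (rule sum.cong[OF refl])
    fix k assume k: "k \<in> {..n}"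
    have "(-1) ^ n * (-1) ^ (n - k) = ((-1) ^ k :: 'a)"
      using k by (simp flip: power_add add: minus_one_power_iff)
    then have "of_nat (n choose k) * (-1) ^ k * pochhammer A k * pochhammer (D + of_nat k) (n - k) =
      of_nat (n choose k) * ((-1) ^ n * (-1) ^ (n - k)) * pochhammer A k * pochhammer (D + of_nat k) (n - k)"
      by simp
    then show "(-1) ^ n * (of_nat (n choose k) * pochhammer A k * pochhammer (1 - of_nat n - D) (n - k)) =
      of_nat (n choose k) * (-1) ^ k * pochhammer A k * pochhammer (D + of_nat k) (n - k)"
      using k by (simp add: pochhammer_reflect mult_ac)
  qed
  finally show ?thesis by simp
qed

lemma pochhammer_neg_of_nat:
  "pochhammer (- of_nat N :: 'a::field_char_0) j = (-1) ^ j * of_nat (N choose j) * fact j"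
  by (simp add: binomial_gbinomial gbinomial_pochhammer)

lemma pochhammer_nonzero:
  "z \<notin> \<int>\<^sub>\<le>\<^sub>0 \<Longrightarrow> pochhammer z n \<noteq> (0::'a::field_char_0)"
  by (auto simp: pochhammer_eq_0_iff)

lemma add_of_nat_notin_nonpos_Ints:
  "z \<notin> \<int>\<^sub>\<le>\<^sub>0 \<Longrightarrow> z + of_nat n \<notin> (\<int>\<^sub>\<le>\<^sub>0 :: 'a::field_char_0 set)"
proof (induction n)
  case (Suc n)
  then show ?case
    using plus_one_in_nonpos_Ints_imp[of "z + of_nat n"] by (auto simp: add_ac)
qed simp

section \<open>Transformations of terminating ${}_3F_2$ polynomials\<close>

text \<open>The polynomial $(D)_N (E)_N\,{}_3F_2(-N,A,B;D,E;1)$. Clearing denominators lets the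
  transformations below hold for all parameters, so that intermediate series whose denominator parameters
  happen to be nonpositive integers need no special treatment.\<close>

definition cleared_3F2 :: "nat \<Rightarrow> 'a \<Rightarrow> 'a \<Rightarrow> 'a \<Rightarrow> 'a \<Rightarrow> 'a::comm_ring_1" where
  "cleared_3F2 N A B D E =
     (\<Sum>j\<le>N. of_nat (N choose j) * (-1) ^ j * pochhammer A j * pochhammer B j *
        pochhammer (D + of_nat j) (N - j) * pochhammer (E + of_nat j) (N - j))"

lemma cleared_3F2_commute_upper: "cleared_3F2 N A B D E = cleared_3F2 N B A D E"
  unfolding cleared_3F2_def by (intro sum.cong) (simp_all add: mult_ac)

lemma cleared_3F2_commute_lower: "cleared_3F2 N A B D E = cleared_3F2 N A B E D"
  unfolding cleared_3F2_def by (intro sum.cong) (simp_all add: mult_ac)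

lemma sum_triangle_swap:
  fixes n :: nat
  shows "(\<Sum>j\<le>n. \<Sum>i\<le>j. g i (j - i)) = (\<Sum>i\<le>n. \<Sum>l\<le>n - i. g i l)"
proof -
  have "(\<Sum>i\<le>n. \<Sum>l\<le>n - i. g i l) = (\<Sum>(i,l)\<in>Sigma {..n} (\<lambda>i. {..n - i}). g i l)"
    by (simp add: sum.Sigma)
  also have "Sigma {..n} (\<lambda>i. {..n - i}) = {(i,l). i + l \<le> n}" by auto
  finally show ?thesis by (simp add: sum.triangle_reindex_eq)
qed

text \<open>The two-term transformation
  ${}_3F_2(-N,A,B;D,E;1) = \frac{(E-A)_N}{(E)_N}\,{}_3F_2(-N,A,D-B;D,1+A-E-N;1)$ of Thomae and Sheppard.
  On the right-hand side, expand $(D-B)_j$ by Chu-Vandermonde, interchange the sums, and apply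
  Chu-Vandermonde once more to the inner sum.\<close>

lemma cleared_3F2_Thomae:
  fixes A B D E :: "'a::comm_ring_1"
  shows "cleared_3F2 N A B D E = (-1) ^ N * cleared_3F2 N A (D - B) D (1 + A - E - of_nat N)"
proof -
  define E' where "E' = 1 + A - E - of_nat N"
  define g where "g i l = of_nat (N choose (i + l)) * of_nat ((i + l) choose i) * (-1) ^ (i + l) * (-1) ^ i *
      pochhammer A (i + l) * pochhammer B i * pochhammer (D + of_nat i) (N - i) *
      pochhammer (E' + of_nat (i + l)) (N - (i + l))" for i l
  \<comment> \<open>The factor containing \<open>D - B\<close> is expanded by Chu-Vandermonde; taking \<open>D\<close> as the lower
      parameter there makes the leftover factors merge into \<open>pochhammer (D + of_nat i) (N - i)\<close>, free of \<open>j\<close>.\<close>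
  have "cleared_3F2 N A (D - B) D E' = (\<Sum>j\<le>N. \<Sum>i\<le>j. g i (j - i))"
    unfolding cleared_3F2_def
  proof (rule sum.cong[OF refl])
    fix j assume j: "j \<in> {..N}"
    have "pochhammer (D - B) j * pochhammer (D + of_nat j) (N - j) =
        (\<Sum>i\<le>j. of_nat (j choose i) * (-1) ^ i * pochhammer B i * pochhammer (D + of_nat i) (N - i))"
      unfolding Chu_Vandermonde[symmetric] sum_distrib_right
      using j by (intro sum.cong) (simp_all add: mult.assoc pochhammer_shift_split)
    moreover have "of_nat (N choose j) * (-1) ^ j * pochhammer A j * pochhammer (D - B) j *
        pochhammer (D + of_nat j) (N - j) * pochhammer (E' + of_nat j) (N - j) =
        of_nat (N choose j) * (-1) ^ j * pochhammer A j * pochhammer (E' + of_nat j) (N - j) *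
        (pochhammer (D - B) j * pochhammer (D + of_nat j) (N - j))"
      by (simp only: mult_ac)
    ultimately have "of_nat (N choose j) * (-1) ^ j * pochhammer A j * pochhammer (D - B) j *
        pochhammer (D + of_nat j) (N - j) * pochhammer (E' + of_nat j) (N - j) =
        of_nat (N choose j) * (-1) ^ j * pochhammer A j * pochhammer (E' + of_nat j) (N - j) *
        (\<Sum>i\<le>j. of_nat (j choose i) * (-1) ^ i * pochhammer B i * pochhammer (D + of_nat i) (N - i))"
      by simp
    also have "\<dots> = (\<Sum>i\<le>j. g i (j - i))"
      unfolding sum_distrib_left g_def by (intro sum.cong) (simp_all add: mult_ac)
    finally show "of_nat (N choose j) * (-1) ^ j * pochhammer A j * pochhammer (D - B) j *
        pochhammer (D + of_nat j) (N - j) * pochhammer (E' + of_nat j) (N - j) = (\<Sum>i\<le>j. g i (j - i))" .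
  qed
  also have "\<dots> = (\<Sum>i\<le>N. \<Sum>l\<le>N - i. g i l)"
    by (rule sum_triangle_swap)
  also have "\<dots> = (-1) ^ N * cleared_3F2 N A B D E"
    unfolding cleared_3F2_def sum_distrib_left
  proof (rule sum.cong[OF refl])
    fix i assume i: "i \<in> {..N}"
    \<comment> \<open>For fixed \<open>i\<close> what remains is again a Chu-Vandermonde sum, now with parameters \<open>A + i\<close> and \<open>E' + i\<close>.\<close>
    have "(\<Sum>l\<le>N - i. g i l) = of_nat (N choose i) * pochhammer A i * pochhammer B i * pochhammer (D + of_nat i) (N - i) *
        (\<Sum>l\<le>N - i. of_nat ((N - i) choose l) * (-1) ^ l * pochhammer (A + of_nat i) l *
            pochhammer (E' + of_nat i + of_nat l) (N - i - l))"
      unfolding sum_distrib_left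
    proof (rule sum.cong[OF refl])
      fix l assume l: "l \<in> {..N - i}"
      have "(N choose (i + l)) * ((i + l) choose i) = (N choose i) * ((N - i) choose l)"
        using choose_mult[of i "i + l" N] i l by simp
      then have c: "of_nat (N choose (i + l)) * of_nat ((i + l) choose i) =
          (of_nat (N choose i) * of_nat ((N - i) choose l) :: 'a)"
        by (metis of_nat_mult)
      have s: "(-1) ^ (i + l) * (-1) ^ i = ((-1) ^ l :: 'a)"
        by (simp add: minus_one_power_iff)
      have "g i l = (of_nat (N choose (i + l)) * of_nat ((i + l) choose i)) * ((-1) ^ (i + l) * (-1) ^ i) *
         pochhammer A (i + l) * pochhammer B i * pochhammer (D + of_nat i) (N - i) *
         pochhammer (E' + of_nat (i + l)) (N - (i + l))"
        by (simp add: g_def mult_ac)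
      then show "g i l = of_nat (N choose i) * pochhammer A i * pochhammer B i * pochhammer (D + of_nat i) (N - i) *
        (of_nat ((N - i) choose l) * (-1) ^ l * pochhammer (A + of_nat i) l *
            pochhammer (E' + of_nat i + of_nat l) (N - i - l))"
        unfolding c s pochhammer_product' by (simp add: mult_ac add_ac)
    qed
    also have "\<dots> = of_nat (N choose i) * pochhammer A i * pochhammer B i * pochhammer (D + of_nat i) (N - i) *
        ((-1) ^ (N - i) * pochhammer (E + of_nat i) (N - i))"
      unfolding Chu_Vandermonde using pochhammer_reflect[of i N E] i
      by (simp add: E'_def algebra_simps)
    also have "(-1) ^ (N - i) = ((-1) ^ N * (-1) ^ i :: 'a)"
      using i by (auto simp add: minus_one_power_iff)
    finally show "(\<Sum>l\<le>N - i. g i l) = (-1) ^ N * (of_nat (N choose i) * (-1) ^ i * pochhammer A i * pochhammer B i *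
        pochhammer (D + of_nat i) (N - i) * pochhammer (E + of_nat i) (N - i))"
      by (simp add: mult_ac)
  qed
  finally show ?thesis
    by (simp add: E'_def flip: mult.assoc power_mult_distrib)
qed

text \<open>Three applications of Thomae's transformation move the integer \<open>n\<close> from a lower to an upper
  parameter. For \<open>n = 0\<close> the right-hand sum reduces to its first term, which is Saalschuetz's theorem.\<close>

lemma cleared_3F2_balanced_shift:
  fixes b c d e :: "'a::comm_ring_1"
  assumes "d + e = 1 + b + c - of_nat N"
  shows "cleared_3F2 N b c (d + of_nat n) e =
         (-1) ^ N * cleared_3F2 N (- of_nat n) (d - b - c) (d - b) (d - c)"
proof -
  have e: "e = 1 + b + c - of_nat N - d" using assms by (simp add: algebra_simps)
  have "cleared_3F2 N b c (d + of_nat n) e = (-1) ^ N * cleared_3F2 N b (d + of_nat n - c) (d + of_nat n) (d - c)"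
    by (subst cleared_3F2_Thomae) (simp add: e algebra_simps)
  also have "cleared_3F2 N b (d + of_nat n - c) (d + of_nat n) (d - c) =
      (-1) ^ N * cleared_3F2 N b (- of_nat n) (d - c) (1 + b - (d + of_nat n) - of_nat N)"
    by (subst cleared_3F2_commute_lower, subst cleared_3F2_Thomae) (simp add: algebra_simps)
  also have "cleared_3F2 N b (- of_nat n) (d - c) (1 + b - (d + of_nat n) - of_nat N) =
      (-1) ^ N * cleared_3F2 N (- of_nat n) (d - b - c) (d - b) (d - c)"
    by (subst cleared_3F2_commute_upper, subst cleared_3F2_Thomae, subst (2) cleared_3F2_commute_lower)
       (simp add: algebra_simps)
  finally show ?thesis by (simp flip: mult.assoc power_mult_distrib)
qed

text \<open>Expanding \<open>pochhammer (d - a + of_nat j) n\<close> on the left by Chu-Vandermonde gives a double sum that is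
  symmetric under exchanging \<open>(M, b)\<close> with \<open>(n, a)\<close>.\<close>

lemma Vandermonde_duality:
  fixes a b d :: "'a::comm_ring_1"
  shows "(\<Sum>j\<le>M. of_nat (M choose j) * (-1) ^ j * pochhammer b j *
            pochhammer (d - a + of_nat j) n * pochhammer (d + of_nat n + of_nat j) (M - j)) =
         (\<Sum>k\<le>n. of_nat (n choose k) * (-1) ^ k * pochhammer a k *
            pochhammer (d - b + of_nat k) M * pochhammer (d + of_nat M + of_nat k) (n - k))"
proof -
  define h where "h M b n a j k = of_nat (M choose j) * of_nat (n choose k) * (-1) ^ (j + k) *
     pochhammer b j * pochhammer a k * pochhammer (d + of_nat (j + k)) (M + n - (j + k))"
     for M n j k :: nat and a b :: 'a
  have expand: "(\<Sum>j\<le>M. of_nat (M choose j) * (-1) ^ j * pochhammer b j *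
            pochhammer (d - a + of_nat j) n * pochhammer (d + of_nat n + of_nat j) (M - j)) =
        (\<Sum>j\<le>M. \<Sum>k\<le>n. h M b n a j k)" for M b n a
  proof (rule sum.cong[OF refl])
    fix j assume j: "j \<in> {..M}"
    have v: "pochhammer (d - a + of_nat j) n =
       (\<Sum>k\<le>n. of_nat (n choose k) * (-1) ^ k * pochhammer a k * pochhammer (d + of_nat j + of_nat k) (n - k))"
      by (subst Chu_Vandermonde) (simp add: algebra_simps)
    show "of_nat (M choose j) * (-1) ^ j * pochhammer b j *
            pochhammer (d - a + of_nat j) n * pochhammer (d + of_nat n + of_nat j) (M - j) =
        (\<Sum>k\<le>n. h M b n a j k)"
      unfolding v sum_distrib_left sum_distrib_right
    proof (rule sum.cong[OF refl])
      fix k assume k: "k \<in> {..n}"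
      have "pochhammer (d + of_nat j + of_nat k) (n - k) * pochhammer (d + of_nat n + of_nat j) (M - j) =
            pochhammer (d + of_nat (j + k)) (M + n - (j + k))"
        using pochhammer_shift_split[of "j + k" "j + n" "M + n" d] j k
        by (simp add: add_ac)
      then show "of_nat (M choose j) * (-1) ^ j * pochhammer b j * (of_nat (n choose k) * (-1) ^ k *
         pochhammer a k * pochhammer (d + of_nat j + of_nat k) (n - k)) *
         pochhammer (d + of_nat n + of_nat j) (M - j) = h M b n a j k"
        by (simp add: h_def power_add mult_ac)
    qed
  qed
  have "h M b n a j k = h n a M b k j" for j k
    by (simp add: h_def mult_ac add_ac)
  then show ?thesis
    unfolding expand by (subst sum.swap) simp
qed

text \<open>A relation between a series that stops at \<open>M\<close> and one that stops at \<open>n\<close>. It replaces the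
  integer \<open>M\<close>, which comes from \<open>c = - M\<close>, by the summation index \<open>n\<close> as the terminating parameter.\<close>

lemma cleared_3F2_duality:
  fixes a b d :: "'a::comm_ring_1"
  shows "pochhammer (d - b) n * pochhammer (d - a) n * cleared_3F2 M b (d - a + of_nat n) (d + of_nat n) (d - a) =
         pochhammer (d - a) M * pochhammer (d - b) M * cleared_3F2 n a (d - b + of_nat M) (d + of_nat M) (d - b)"
proof -
  have clear: "pochhammer (d - a) n * cleared_3F2 M b (d - a + of_nat n) (d + of_nat n) (d - a) =
     pochhammer (d - a) M * (\<Sum>j\<le>M. of_nat (M choose j) * (-1) ^ j * pochhammer b j *
            pochhammer (d - a + of_nat j) n * pochhammer (d + of_nat n + of_nat j) (M - j))" for a b n M
    unfolding cleared_3F2_def sum_distrib_left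
  proof (rule sum.cong[OF refl])
    fix j assume j: "j \<in> {..M}"
    have 1: "pochhammer (d - a) n * pochhammer (d - a + of_nat n) j = pochhammer (d - a) j * pochhammer (d - a + of_nat j) n"
      by (metis add.commute pochhammer_product')
    have 2: "pochhammer (d - a) j * pochhammer (d - a + of_nat j) (M - j) = pochhammer (d - a) M"
      using j pochhammer_split by auto
    have "pochhammer (d - a) n * (of_nat (M choose j) * (-1) ^ j * pochhammer b j * pochhammer (d - a + of_nat n) j *
        pochhammer (d + of_nat n + of_nat j) (M - j) * pochhammer (d - a + of_nat j) (M - j)) =
       of_nat (M choose j) * (-1) ^ j * pochhammer b j * (pochhammer (d - a) n * pochhammer (d - a + of_nat n) j) *
        pochhammer (d + of_nat n + of_nat j) (M - j) * pochhammer (d - a + of_nat j) (M - j)"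
      by (simp only: mult_ac)
    also have "\<dots> = (pochhammer (d - a) j * pochhammer (d - a + of_nat j) (M - j)) * (of_nat (M choose j) * (-1) ^ j * pochhammer b j *
            pochhammer (d - a + of_nat j) n * pochhammer (d + of_nat n + of_nat j) (M - j))"
      unfolding 1 by (simp only: mult_ac)
    finally show "pochhammer (d - a) n * (of_nat (M choose j) * (-1) ^ j * pochhammer b j * pochhammer (d - a + of_nat n) j *
        pochhammer (d + of_nat n + of_nat j) (M - j) * pochhammer (d - a + of_nat j) (M - j)) =
        pochhammer (d - a) M * (of_nat (M choose j) * (-1) ^ j * pochhammer b j *
            pochhammer (d - a + of_nat j) n * pochhammer (d + of_nat n + of_nat j) (M - j))"
      unfolding 2 .
  qed
  have "pochhammer (d - b) n * pochhammer (d - a) n *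
          cleared_3F2 M b (d - a + of_nat n) (d + of_nat n) (d - a) =
        pochhammer (d - b) n * (pochhammer (d - a) n *
          cleared_3F2 M b (d - a + of_nat n) (d + of_nat n) (d - a))"
    by (simp only: mult_ac)
  also have "\<dots> = pochhammer (d - a) M * (pochhammer (d - b) M *
      cleared_3F2 n a (d - b + of_nat M) (d + of_nat M) (d - b))"
    unfolding clear Vandermonde_duality[of M b d a n] by (simp only: mult_ac)
  finally show ?thesis by (simp only: mult_ac)
qed

section \<open>The inner sum of the double series\<close>

definition trunc_3F2 :: "nat \<Rightarrow> 'a \<Rightarrow> 'a \<Rightarrow> 'a \<Rightarrow> 'a \<Rightarrow> 'a \<Rightarrow> 'a::field_char_0" where
  "trunc_3F2 K a b c d e =
     (\<Sum>k\<le>K. pochhammer a k * pochhammer b k * pochhammer c k / (pochhammer d k * pochhammer e k * fact k))"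

lemma trunc_3F2_permute:
  "trunc_3F2 K a b c d e = trunc_3F2 K b a c d e"
  "trunc_3F2 K a b c d e = trunc_3F2 K a c b d e"
  "trunc_3F2 K a b c d e = trunc_3F2 K a b c e d"
  by (simp_all add: trunc_3F2_def mult_ac)

lemma cleared_3F2_eq_trunc:
  fixes D E :: "'a::field_char_0"
  assumes "pochhammer D N \<noteq> 0" "pochhammer E N \<noteq> 0"
  shows "cleared_3F2 N A B D E =
         pochhammer D N * pochhammer E N * trunc_3F2 N (- of_nat N) A B D E"
  unfolding cleared_3F2_def trunc_3F2_def sum_distrib_left
proof (rule sum.cong[OF refl])
  fix j assume j: "j \<in> {..N}"
  have "pochhammer D j \<noteq> 0" "pochhammer E j \<noteq> 0"
    using assms j pochhammer_neq_0_mono by auto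
  moreover have "pochhammer D N = pochhammer D j * pochhammer (D + of_nat j) (N - j)"
                "pochhammer E N = pochhammer E j * pochhammer (E + of_nat j) (N - j)"
    using j pochhammer_product by auto
  ultimately show "of_nat (N choose j) * (-1) ^ j * pochhammer A j * pochhammer B j *
      pochhammer (D + of_nat j) (N - j) * pochhammer (E + of_nat j) (N - j) =
      pochhammer D N * pochhammer E N * (pochhammer (- of_nat N) j * pochhammer A j * pochhammer B j /
      (pochhammer D j * pochhammer E j * fact j))"
    by (simp add: pochhammer_neg_of_nat)
qed

text \<open>The sum over \<open>m\<close> of the double series for fixed \<open>n\<close>, when \<open>a\<close> terminates it. The outcome is a
  combination of the polynomials \<open>pochhammer (- of_nat n) k\<close> in \<open>n\<close> whose coefficients do not depend on \<open>n\<close>;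
  this is what makes the sum over \<open>n\<close> accessible to Gauss's theorem.\<close>

lemma row_sum_terminating_left:
  fixes a b c d e :: "'a::field_char_0"
  assumes a: "a = - of_nat N" and bal: "d + e - a - b - c = 1"
    and "d \<notin> \<int>\<^sub>\<le>\<^sub>0" "e \<notin> \<int>\<^sub>\<le>\<^sub>0" "d - b \<notin> \<int>\<^sub>\<le>\<^sub>0" "d - c \<notin> \<int>\<^sub>\<le>\<^sub>0"
  shows "pochhammer (d - a) n / pochhammer d n * trunc_3F2 N a b c (d + of_nat n) e =
         (-1) ^ N * (pochhammer (d - b) N * pochhammer (d - c) N / (pochhammer d N * pochhammer e N)) *
         trunc_3F2 N a (- of_nat n) (d - b - c) (d - b) (d - c)"
proof -
  have nz: "pochhammer d n \<noteq> 0" "pochhammer d N \<noteq> 0" "pochhammer e N \<noteq> 0" "pochhammer (d - b) N \<noteq> 0"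
      "pochhammer (d - c) N \<noteq> 0" "pochhammer (d + of_nat n) N \<noteq> 0"
    using assms(3-) by (simp_all add: pochhammer_nonzero add_of_nat_notin_nonpos_Ints)
  have comm: "pochhammer d N * pochhammer (d + of_nat N) n = pochhammer d n * pochhammer (d + of_nat n) N"
    by (metis add.commute pochhammer_product')
  have "pochhammer d n * pochhammer (d + of_nat n) N * pochhammer e N * trunc_3F2 N a b c (d + of_nat n) e =
      pochhammer d n * ((-1) ^ N * cleared_3F2 N (- of_nat n) (d - b - c) (d - b) (d - c))"
    using cleared_3F2_eq_trunc[of "d + of_nat n" N e b c] nz
      cleared_3F2_balanced_shift[of d e b c N n] bal by (simp add: a algebra_simps)
  also have "\<dots> = pochhammer d n * (-1) ^ N * pochhammer (d - b) N * pochhammer (d - c) N *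
      trunc_3F2 N a (- of_nat n) (d - b - c) (d - b) (d - c)"
    using nz by (simp add: cleared_3F2_eq_trunc a)
  finally have "pochhammer d N * pochhammer (d - a) n * pochhammer e N * trunc_3F2 N a b c (d + of_nat n) e = \<dots>"
    by (simp add: comm a)
  then show ?thesis
    using nz by (simp add: field_simps)
qed

text \<open>The same identity when \<open>c\<close> terminates the sum and \<open>a\<close> is arbitrary. Here the right-hand side is
  terminated by \<open>n\<close> alone, so duality is needed in addition to Thomae's transformation.\<close>

lemma row_sum_terminating_right:
  fixes a b c d e :: "'a::field_char_0"
  assumes c: "c = - of_nat M" and bal: "d + e - a - b - c = 1"
    and "d \<notin> \<int>\<^sub>\<le>\<^sub>0" "e \<notin> \<int>\<^sub>\<le>\<^sub>0" "d - b \<notin> \<int>\<^sub>\<le>\<^sub>0"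
  shows "pochhammer (d - a) n / pochhammer d n * trunc_3F2 M a b c (d + of_nat n) e =
         (-1) ^ M * (pochhammer (d - a) M * pochhammer (d - b) M / (pochhammer d M * pochhammer e M)) *
         trunc_3F2 n a (- of_nat n) (d - b - c) (d - b) (d - c)"
proof -
  have nz: "pochhammer d n \<noteq> 0" "pochhammer d M \<noteq> 0" "pochhammer e M \<noteq> 0" "pochhammer (d - b) n \<noteq> 0"
      "pochhammer (d + of_nat n) M \<noteq> 0" "pochhammer (d + of_nat M) n \<noteq> 0"
    using assms(3-) by (simp_all add: pochhammer_nonzero add_of_nat_notin_nonpos_Ints)
  have comm: "pochhammer d M * pochhammer (d + of_nat M) n = pochhammer d n * pochhammer (d + of_nat n) M"
    by (metis add.commute pochhammer_product')
  have e: "1 + b - e - of_nat M = d - a" using bal c by (simp add: algebra_simps)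
  define L where "L = trunc_3F2 M a b c (d + of_nat n) e"
  define R where "R = trunc_3F2 n a (- of_nat n) (d - b - c) (d - b) (d - c)"
  have L: "pochhammer (d + of_nat n) M * pochhammer e M * L = cleared_3F2 M b a (d + of_nat n) e"
    using cleared_3F2_eq_trunc[of "d + of_nat n" M e a b] nz
    by (simp add: L_def c cleared_3F2_commute_upper[of M b] trunc_3F2_permute(1)[of _ a] trunc_3F2_permute(2)[of _ _ a])
       (metis trunc_3F2_permute)
  have R: "pochhammer (d + of_nat M) n * pochhammer (d - b) n * R =
      cleared_3F2 n a (d - b + of_nat M) (d + of_nat M) (d - b)"
    using nz trunc_3F2_permute(1)[of n a] trunc_3F2_permute(3)[of n _ _ _ "d - b"]
    by (simp add: cleared_3F2_eq_trunc R_def c)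
  have "cleared_3F2 M b a (d + of_nat n) e =
      (-1) ^ M * cleared_3F2 M b (d - a + of_nat n) (d + of_nat n) (d - a)"
    by (subst cleared_3F2_Thomae, subst e) (simp add: algebra_simps)
  then have "pochhammer (d - b) n * (pochhammer (d - a) n * (pochhammer (d + of_nat n) M * pochhammer e M * L)) =
      (-1) ^ M * (pochhammer (d - b) n * pochhammer (d - a) n *
         cleared_3F2 M b (d - a + of_nat n) (d + of_nat n) (d - a))"
    unfolding L by (simp only: mult_ac)
  also have "\<dots> = pochhammer (d - b) n *
      ((-1) ^ M * pochhammer (d - a) M * pochhammer (d - b) M * (pochhammer (d + of_nat M) n * R))"
    unfolding cleared_3F2_duality R[symmetric] by (simp only: mult_ac)
  finally have "pochhammer (d - a) n * (pochhammer (d + of_nat n) M * pochhammer e M * L) =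
      (-1) ^ M * pochhammer (d - a) M * pochhammer (d - b) M * (pochhammer (d + of_nat M) n * R)"
    using nz by simp
  then have "pochhammer d n * pochhammer (d + of_nat n) M * (pochhammer d M * pochhammer e M * pochhammer (d - a) n * L) =
      pochhammer d M * pochhammer (d + of_nat M) n * ((-1) ^ M * pochhammer (d - a) M * pochhammer (d - b) M * pochhammer d n * R)"
    by (simp add: mult_ac)
  then have "pochhammer d M * pochhammer e M * pochhammer (d - a) n * L =
      (-1) ^ M * pochhammer (d - a) M * pochhammer (d - b) M * pochhammer d n * R"
    unfolding comm using nz by simp
  then show ?thesis
    unfolding L_def[symmetric] R_def[symmetric] using nz by (simp add: field_simps)
qed

lemma Gamma_mult_rGamma:
  fixes z :: complex
  shows "z + of_nat n \<notin> \<int>\<^sub>\<le>\<^sub>0 \<Longrightarrow> Gamma (z + of_nat n) * rGamma z = pochhammer z n"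
  by (subst pochhammer_rGamma[of z n]) (simp add: Gamma_def rGamma_eq_zero_iff)

lemma Gamma_mult_rGamma':
  fixes z :: complex
  shows "z \<notin> \<int>\<^sub>\<le>\<^sub>0 \<Longrightarrow> Gamma z * rGamma (z + of_nat n) = 1 / pochhammer z n"
proof -
  assume "z \<notin> \<int>\<^sub>\<le>\<^sub>0"
  then have "rGamma z \<noteq> 0" by (simp add: rGamma_eq_zero_iff)
  then show ?thesis
    using pochhammer_rGamma[of z n] by (auto simp: Gamma_def field_simps)
qed

text \<open>The Gamma prefactor is Saalschuetz's value of ${}_3F_2(x,y,z;d,e;1)$. It is symmetric in \<open>x, y, z\<close>,
  so it serves for whichever of them terminates the series.\<close>

lemma Saalschuetz_Gamma_quotient:
  fixes x y z e d :: complex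
  assumes x: "x = - of_nat N" and bal: "d + e - x - y - z = 1"
    and "e \<notin> \<int>\<^sub>\<le>\<^sub>0" "e - x - y \<notin> \<int>\<^sub>\<le>\<^sub>0" "e - x - z \<notin> \<int>\<^sub>\<le>\<^sub>0" "e - y - z \<notin> \<int>\<^sub>\<le>\<^sub>0"
  shows "Gamma e * Gamma (e - x - y) * Gamma (e - x - z) * Gamma (e - y - z) *
         (rGamma (e - x) * rGamma (e - y) * rGamma (e - z) * rGamma (e - x - y - z)) =
         (-1) ^ N * (pochhammer (d - y) N * pochhammer (d - z) N / (pochhammer d N * pochhammer e N))"
proof -
  have "Gamma e * Gamma (e - x - y) * Gamma (e - x - z) * Gamma (e - y - z) *
         (rGamma (e - x) * rGamma (e - y) * rGamma (e - z) * rGamma (e - x - y - z)) =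
        (Gamma e * rGamma (e + of_nat N)) * (Gamma (e - y - z) * rGamma (e - y - z + of_nat N)) *
        (Gamma (e - y + of_nat N) * rGamma (e - y)) * (Gamma (e - z + of_nat N) * rGamma (e - z))"
    by (simp add: x algebra_simps)
  also have "Gamma e * rGamma (e + of_nat N) = 1 / pochhammer e N"
    using assms(3) by (rule Gamma_mult_rGamma')
  also have "Gamma (e - y - z) * rGamma (e - y - z + of_nat N) = 1 / pochhammer (e - y - z) N"
    using assms(6) by (rule Gamma_mult_rGamma')
  also have "Gamma (e - y + of_nat N) * rGamma (e - y) = pochhammer (e - y) N"
    using assms(4) by (intro Gamma_mult_rGamma) (simp add: x algebra_simps)
  also have "Gamma (e - z + of_nat N) * rGamma (e - z) = pochhammer (e - z) N"
    using assms(5) by (intro Gamma_mult_rGamma) (simp add: x algebra_simps)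
  finally have eq: "Gamma e * Gamma (e - x - y) * Gamma (e - x - z) * Gamma (e - y - z) *
         (rGamma (e - x) * rGamma (e - y) * rGamma (e - z) * rGamma (e - x - y - z)) =
        1 / pochhammer e N * (1 / pochhammer (e - y - z) N) * pochhammer (e - y) N * pochhammer (e - z) N" .
  have reflect: "e - y = 1 - of_nat N - (d - z)" "e - z = 1 - of_nat N - (d - y)"
      "e - y - z = 1 - of_nat N - d"
    using bal by (simp_all add: x algebra_simps)
  have reflect0: "pochhammer (1 - of_nat N - D) N = (-1) ^ N * pochhammer D N" for D :: complex
    using pochhammer_reflect[of 0 N D] by simp
  have "pochhammer (e - y) N = (-1) ^ N * pochhammer (d - z) N"
    unfolding reflect(1) by (rule reflect0)
  moreover have "pochhammer (e - z) N = (-1) ^ N * pochhammer (d - y) N"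
    unfolding reflect(2) by (rule reflect0)
  moreover have "pochhammer (e - y - z) N = (-1) ^ N * pochhammer d N"
    unfolding reflect(3) by (rule reflect0)
  ultimately show ?thesis
    unfolding eq by (simp add: field_simps)
qed

section \<open>Gauss's summation theorem\<close>

definition Gauss_term :: "'a::field_char_0 \<Rightarrow> 'a \<Rightarrow> 'a \<Rightarrow> nat \<Rightarrow> 'a" where
  "Gauss_term b c e n = pochhammer b n * pochhammer c n / (pochhammer e n * fact n)"

lemma Gauss_term_0 [simp]: "Gauss_term b c e 0 = 1"
  by (simp add: Gauss_term_def)

text \<open>The Gamma limit $(z)_{n+1} \approx n!\,n^z/\Gamma(z)$, applied to each of the three rising factorials,
  shows that the terms are of order at most $n^{\mathrm{Re}(b+c-e)-1}$.\<close>

lemma Gauss_term_bound: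
  fixes b c e :: complex
  assumes "e \<notin> \<int>\<^sub>\<le>\<^sub>0"
  obtains C where "\<And>n. n > 0 \<Longrightarrow> norm (of_nat (Suc n) * Gauss_term b c e (Suc n)) \<le> C * real n powr (Re (b + c - e))"
proof -
  define r where "r n = rGamma_series b n * rGamma_series c n / rGamma_series e n" for n
  have "r \<longlonglongrightarrow> rGamma b * rGamma c / rGamma e"
    unfolding r_def using assms by (intro tendsto_intros) (simp add: rGamma_eq_zero_iff)
  then have "Bseq r"
    by (intro convergent_imp_Bseq convergentI)
  then obtain C where C: "\<And>n. norm (r n) \<le> C"
    by (auto simp: Bseq_def)
  have "norm (of_nat (Suc n) * Gauss_term b c e (Suc n)) \<le> C * real n powr (Re (b + c - e))" if "n > 0" for n
  proof -
    have "of_nat (Suc n) * Gauss_term b c e (Suc n) = r n * exp ((b + c - e) * of_real (ln (of_nat n)))"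
    proof -
      define X Y Z where "X = exp (b * of_real (ln (of_nat n)))" and "Y = exp (c * of_real (ln (of_nat n)))"
        and "Z = exp (e * of_real (ln (of_nat n)) :: complex)"
      have "X \<noteq> 0" "Y \<noteq> 0" "Z \<noteq> 0" by (auto simp: X_def Y_def Z_def)
      moreover have "exp ((b + c - e) * of_real (ln (of_nat n))) = X * Y / Z"
        by (simp add: X_def Y_def Z_def ring_distribs exp_add exp_diff)
      moreover have "of_nat (Suc n) / fact (Suc n) = (1 / fact n :: complex)"
        by (simp add: divide_simps del: of_nat_Suc)
      moreover have "of_nat (Suc n) * Gauss_term b c e (Suc n) =
          pochhammer b (Suc n) * pochhammer c (Suc n) / pochhammer e (Suc n) * (of_nat (Suc n) / fact (Suc n))"
        by (simp add: Gauss_term_def)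
      ultimately show ?thesis
        using pochhammer_nonzero[OF assms, of "Suc n"]
        by (simp add: r_def rGamma_series_def flip: X_def Y_def Z_def)
    qed
    also have "norm \<dots> = norm (r n) * real n powr (Re (b + c - e))"
      using that by (simp add: norm_mult powr_def)
    also have "\<dots> \<le> C * real n powr (Re (b + c - e))"
      using C by (intro mult_right_mono) auto
    finally show ?thesis .
  qed
  then show ?thesis by (rule that)
qed

lemma Gauss_term_summable:
  fixes b c e :: complex
  assumes "e \<notin> \<int>\<^sub>\<le>\<^sub>0" "Re (e - b - c) > 0"
  shows "summable (\<lambda>n. norm (Gauss_term b c e n))"
proof -
  obtain C where C: "\<And>n. n > 0 \<Longrightarrow> norm (of_nat (Suc n) * Gauss_term b c e (Suc n)) \<le> C * real n powr (Re (b + c - e))"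
    using Gauss_term_bound[OF assms(1)] by blast
  have "summable (\<lambda>n. norm (Gauss_term b c e (Suc n)))"
  proof (rule summable_comparison_test')
    show "summable (\<lambda>n. C * real n powr (Re (b + c - e) - 1))"
      using assms by (intro summable_mult) (simp add: summable_real_powr_iff)
    fix n :: nat assume n: "n \<ge> 1"
    have "norm (Gauss_term b c e (Suc n)) = norm (of_nat (Suc n) * Gauss_term b c e (Suc n)) / real (Suc n)"
      by (simp add: norm_mult del: of_nat_Suc)
    also have "\<dots> \<le> norm (of_nat (Suc n) * Gauss_term b c e (Suc n)) / real n"
      using n by (intro divide_left_mono) auto
    also have "\<dots> \<le> C * real n powr (Re (b + c - e)) / real n"
      using n C by (intro divide_right_mono) auto
    also have "\<dots> = C * real n powr (Re (b + c - e) - 1)"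
      using n by (simp add: powr_diff)
    finally show "norm (norm (Gauss_term b c e (Suc n))) \<le> C * real n powr (Re (b + c - e) - 1)"
      by simp
  qed
  then show ?thesis by (subst (asm) summable_Suc_iff)
qed

lemma Gauss_term_mult_index_tendsto_0:
  fixes b c e :: complex
  assumes "e \<notin> \<int>\<^sub>\<le>\<^sub>0" "Re (e - b - c) > 0"
  shows "(\<lambda>n. of_nat n * Gauss_term b c e n) \<longlonglongrightarrow> 0"
proof -
  obtain C where C: "\<And>n. n > 0 \<Longrightarrow> norm (of_nat (Suc n) * Gauss_term b c e (Suc n)) \<le> C * real n powr (Re (b + c - e))"
    using Gauss_term_bound[OF assms(1)] by blast
  have "(\<lambda>n. of_nat (Suc n) * Gauss_term b c e (Suc n)) \<longlonglongrightarrow> 0"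
  proof (rule Lim_null_comparison)
    show "\<forall>\<^sub>F n in sequentially. norm (of_nat (Suc n) * Gauss_term b c e (Suc n)) \<le> C * real n powr (Re (b + c - e))"
      using eventually_gt_at_top[of 0] by eventually_elim (rule C)
    have "(\<lambda>n. real n powr (Re (b + c - e))) \<longlonglongrightarrow> 0"
      using assms by (intro tendsto_neg_powr filterlim_real_sequentially) simp
    then show "(\<lambda>n. C * real n powr (Re (b + c - e))) \<longlonglongrightarrow> 0"
      using tendsto_mult_right_zero by blast
  qed
  then show ?thesis by (rule LIMSEQ_imp_Suc)
qed

text \<open>The contiguous relation in \<open>e\<close> in telescoping form: the difference of the two sides of
  $e(e-b-c)F(e) = (e-b)(e-c)F(e+1)$ is, term by term, a difference of consecutive values of $e\,n\,t_n$.\<close>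

lemma Gauss_term_contiguous:
  fixes b c e :: complex
  assumes "e \<notin> \<int>\<^sub>\<le>\<^sub>0"
  shows "e * (e - b - c) * Gauss_term b c e n - (e - b) * (e - c) * Gauss_term b c (e + 1) n =
         e * (of_nat n * Gauss_term b c e n - of_nat (Suc n) * Gauss_term b c e (Suc n))"
proof -
  have "e \<noteq> 0" using assms by auto
  have en: "e + of_nat n \<noteq> 0" 
    using pochhammer_nonzero[OF assms, of "Suc n"] by (auto simp: pochhammer_Suc)
  have p: "pochhammer e n * (e + of_nat n) = e * pochhammer (e + 1) n"
    by (metis pochhammer_Suc pochhammer_rec)
  then have p1: "pochhammer (e + 1) n = pochhammer e n * (e + of_nat n) / e"
    using \<open>e \<noteq> 0\<close> by (simp add: field_simps)
  define t where "t = Gauss_term b c e n"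
  have 1: "Gauss_term b c (e + 1) n = t * e / (e + of_nat n)"
    by (simp add: Gauss_term_def t_def p1)
  have 2: "of_nat (Suc n) * Gauss_term b c e (Suc n) = t * ((b + of_nat n) * (c + of_nat n)) / (e + of_nat n)"
    by (simp add: Gauss_term_def t_def pochhammer_Suc divide_simps del: of_nat_Suc)
  show ?thesis
    unfolding 1 2 t_def[symmetric] using en by (simp add: field_simps)
qed

lemma Gauss_contiguous:
  fixes b c e :: complex
  assumes "e \<notin> \<int>\<^sub>\<le>\<^sub>0" "Re (e - b - c) > 0"
  shows "e * (e - b - c) * suminf (Gauss_term b c e) = (e - b) * (e - c) * suminf (Gauss_term b c (e + 1))"
proof -
  have e1: "e + 1 \<notin> \<int>\<^sub>\<le>\<^sub>0" 
    using assms(1) plus_one_in_nonpos_Ints_imp by blast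
  have s: "summable (Gauss_term b c e)" "summable (Gauss_term b c (e + 1))"
    using Gauss_term_summable[OF assms] Gauss_term_summable[OF e1, of b c] assms(2)
    by (auto intro: summable_norm_cancel)
  have "(\<lambda>n. of_nat n * Gauss_term b c e n - of_nat (Suc n) * Gauss_term b c e (Suc n)) sums
        (of_nat 0 * Gauss_term b c e 0 - 0)"
    by (rule telescope_sums'[OF Gauss_term_mult_index_tendsto_0[OF assms]])
  from sums_mult[OF this, of e] 
  have "(\<lambda>n. e * (e - b - c) * Gauss_term b c e n - (e - b) * (e - c) * Gauss_term b c (e + 1) n) sums 0"
    by (simp add: Gauss_term_contiguous[OF assms(1)])
  moreover have "(\<lambda>n. e * (e - b - c) * Gauss_term b c e n - (e - b) * (e - c) * Gauss_term b c (e + 1) n) sums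
      (e * (e - b - c) * suminf (Gauss_term b c e) - (e - b) * (e - c) * suminf (Gauss_term b c (e + 1)))"
    using s by (intro sums_diff sums_mult summable_sums)
  ultimately show ?thesis
    using sums_unique2 by fastforce
qed

lemma Gauss_contiguous_iterated:
  fixes b c e :: complex
  assumes "e \<notin> \<int>\<^sub>\<le>\<^sub>0" "Re (e - b - c) > 0"
  shows "pochhammer e k * pochhammer (e - b - c) k * suminf (Gauss_term b c e) =
         pochhammer (e - b) k * pochhammer (e - c) k * suminf (Gauss_term b c (e + of_nat k))"
proof (induction k)
  case (Suc k)
  have ek: "e + of_nat k \<notin> \<int>\<^sub>\<le>\<^sub>0"
    using assms(1) by (rule add_of_nat_notin_nonpos_Ints)
  have "pochhammer e (Suc k) * pochhammer (e - b - c) (Suc k) * suminf (Gauss_term b c e) =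
      (e + of_nat k) * (e + of_nat k - b - c) * (pochhammer e k * pochhammer (e - b - c) k * suminf (Gauss_term b c e))"
    by (simp add: pochhammer_Suc algebra_simps)
  also have "\<dots> = pochhammer (e - b) k * pochhammer (e - c) k *
      ((e + of_nat k) * (e + of_nat k - b - c) * suminf (Gauss_term b c (e + of_nat k)))"
    unfolding Suc.IH by (simp only: mult_ac)
  also have "\<dots> = pochhammer (e - b) (Suc k) * pochhammer (e - c) (Suc k) * suminf (Gauss_term b c (e + of_nat (Suc k)))"
    using assms(2) by (subst Gauss_contiguous[OF ek]) (simp_all add: pochhammer_Suc algebra_simps)
  finally show ?case .
qed simp

lemma norm_pochhammer_le:
  fixes b :: "'a::real_normed_field"
  shows "norm (pochhammer b n) \<le> pochhammer (norm b) n"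
proof (induction n)
  case (Suc n)
  have "norm (b + of_nat n) \<le> norm b + real n"
    using norm_triangle_ineq[of b "of_nat n"] by simp
  with Suc show ?case
    by (simp add: pochhammer_Suc norm_mult mult_mono')
qed simp

lemma pochhammer_nonneg_real: "0 \<le> r \<Longrightarrow> 0 \<le> pochhammer (r::real) n"
  by (simp add: pochhammer_prod prod_nonneg)

lemma pochhammer_Re_le:
  fixes e :: complex
  assumes "r \<ge> 0" "r \<le> Re e"
  shows "pochhammer r n \<le> norm (pochhammer e n)"
proof (induction n)
  case (Suc n)
  have "r + real n \<le> norm (e + of_nat n)"
    using complex_Re_le_cmod[of "e + of_nat n"] assms by simp
  with Suc show ?case using assms
    by (simp add: pochhammer_Suc norm_mult mult_mono)
qed simp

lemma pochhammer_mono_real: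
  fixes r s :: real
  assumes "0 \<le> r" "r \<le> s"
  shows "pochhammer r n \<le> pochhammer s n"
  unfolding pochhammer_prod using assms by (intro prod_mono) auto

lemma Gauss_suminf_tendsto_1:
  fixes b c e :: complex
  shows "(\<lambda>k. suminf (Gauss_term b c (e + of_nat k))) \<longlonglongrightarrow> 1"
proof -
  \<comment> \<open>After shifting \<open>e\<close> far enough to the right, the series with \<open>b, c, e\<close> replaced by
      \<open>norm b, norm c, r\<close> is a convergent majorant, and a further shift by \<open>k\<close> gains
      the factor \<open>r / (r + k)\<close> in every term but the first.\<close>
  obtain k0 :: nat where k0: "real k0 > norm b + norm c + 1 - Re e"
    using reals_Archimedean2 by blast
  define r where "r = Re e + real k0"
  have r: "r > norm b + norm c + 1" using k0 by (simp add: r_def)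
  then have r0: "r > 0" using norm_ge_zero[of b] norm_ge_zero[of c] by linarith
  define t where "t n = pochhammer (norm b) n * pochhammer (norm c) n / (pochhammer r n * fact n)" for n
  have t_eq: "t n = norm (Gauss_term (complex_of_real (norm b)) (of_real (norm c)) (of_real r) n)" for n
  proof -
    have "Gauss_term (of_real (norm b)) (of_real (norm c)) (of_real r) n = complex_of_real (t n)"
      by (simp add: t_def Gauss_term_def pochhammer_of_real)
    moreover have "t n \<ge> 0"
      using r0 by (auto simp: t_def intro!: divide_nonneg_nonneg mult_nonneg_nonneg pochhammer_nonneg_real)
    ultimately show ?thesis by simp
  qed
  have t: "summable t"
    unfolding t_eq using r r0 by (intro Gauss_term_summable) (auto elim!: nonpos_Ints_cases simp: complex_eq_iff)
  have bound: "norm (Gauss_term b c (e + of_nat (k + k0)) (Suc n)) \<le> r / (r + real k) * t (Suc n)" for k n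
  proof -
    have p: "pochhammer r (Suc n) > 0" using r0 by (rule pochhammer_pos)
    have "(r + real k) / r * pochhammer r (Suc n) = (r + real k) * pochhammer (r + 1) n"
      using r0 by (simp add: pochhammer_rec)
    also have "\<dots> \<le> (r + real k) * pochhammer (r + real k + 1) n"
      using r0 by (intro mult_left_mono pochhammer_mono_real) auto
    also have "\<dots> = pochhammer (r + real k) (Suc n)"
      by (simp add: pochhammer_rec)
    also have "\<dots> \<le> norm (pochhammer (e + of_nat (k + k0)) (Suc n))"
      using r0 by (intro pochhammer_Re_le) (auto simp: r_def)
    finally have d: "(r + real k) / r * pochhammer r (Suc n) \<le> norm (pochhammer (e + of_nat (k + k0)) (Suc n))" .
    have "norm (Gauss_term b c (e + of_nat (k + k0)) (Suc n)) =
        norm (pochhammer b (Suc n)) * norm (pochhammer c (Suc n)) /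
        (norm (pochhammer (e + of_nat (k + k0)) (Suc n)) * fact (Suc n))"
      unfolding Gauss_term_def norm_divide norm_mult norm_fact ..
    also have "\<dots> \<le> pochhammer (norm b) (Suc n) * pochhammer (norm c) (Suc n) /
        ((r + real k) / r * pochhammer r (Suc n) * fact (Suc n))"
      using d r0 p
      by (intro frac_le mult_mono norm_pochhammer_le mult_right_mono mult_pos_pos mult_nonneg_nonneg pochhammer_nonneg_real) auto
    also have "\<dots> = r / (r + real k) * t (Suc n)"
      by (simp add: t_def mult_ac)
    finally show ?thesis .
  qed
  have t1: "summable (\<lambda>n. t (Suc n))" using t by (subst summable_Suc_iff)
  have "norm (suminf (Gauss_term b c (e + of_nat (k + k0))) - 1) \<le> r / (r + real k) * (\<Sum>n. t (Suc n))" for k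
  proof -
    have s: "summable (\<lambda>n. norm (Gauss_term b c (e + of_nat (k + k0)) (Suc n)))"
      using bound[of k] by (intro summable_comparison_test'[OF summable_mult[OF t1], of 0 _ "r / (r + real k)"]) simp
    then have "summable (Gauss_term b c (e + of_nat (k + k0)))"
      by (subst (asm) summable_Suc_iff) (rule summable_norm_cancel)
    then have "suminf (Gauss_term b c (e + of_nat (k + k0))) - 1 = (\<Sum>n. Gauss_term b c (e + of_nat (k + k0)) (Suc n))"
      by (subst suminf_split_head) simp_all
    also have "norm \<dots> \<le> (\<Sum>n. norm (Gauss_term b c (e + of_nat (k + k0)) (Suc n)))"
      by (rule summable_norm[OF s])
    also have "\<dots> \<le> (\<Sum>n. r / (r + real k) * t (Suc n))"
      by (rule suminf_le[OF bound s summable_mult[OF t1]])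
    also have "\<dots> = r / (r + real k) * (\<Sum>n. t (Suc n))"
      by (rule suminf_mult[OF t1])
    finally show ?thesis .
  qed
  moreover have "(\<lambda>k. r / (r + real k) * (\<Sum>n. t (Suc n))) \<longlonglongrightarrow> 0"
  proof -
    have "filterlim (\<lambda>k. r + real k) at_top sequentially"
      by (rule filterlim_tendsto_add_at_top[OF tendsto_const filterlim_real_sequentially])
    then have "(\<lambda>k. r / (r + real k)) \<longlonglongrightarrow> 0"
      by (rule real_tendsto_divide_at_top[OF tendsto_const])
    then show ?thesis by (rule tendsto_mult_left_zero)
  qed
  ultimately have "(\<lambda>k. suminf (Gauss_term b c (e + of_nat (k + k0))) - 1) \<longlonglongrightarrow> 0"
    by (rule Lim_null_comparison[OF always_eventually[OF allI]])
  then have "(\<lambda>k. suminf (Gauss_term b c (e + of_nat (k + k0)))) \<longlonglongrightarrow> 1"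
    by (subst (asm) LIM_zero_iff)
  then show ?thesis by (rule LIMSEQ_offset)
qed

text \<open>Iterating the contiguous relation gives
  $F(e) = \frac{(e-b)_k(e-c)_k}{(e)_k(e-b-c)_k}F(e+k)$. As $k\to\infty$ the last factor tends to 1 and the
  quotient tends to the quotient of Gamma values.\<close>

theorem Gauss_summation:
  fixes b c e :: complex
  assumes "e \<notin> \<int>\<^sub>\<le>\<^sub>0" "Re (e - b - c) > 0"
  shows "(Gauss_term b c e has_sum Gamma e * Gamma (e - b - c) * rGamma (e - b) * rGamma (e - c)) UNIV"
proof -
  define F where "F = suminf (Gauss_term b c e)"
  define F' where "F' k = suminf (Gauss_term b c (e + of_nat (Suc k)))" for k
  have F': "F' \<longlonglongrightarrow> 1"
    unfolding F'_def by (rule LIMSEQ_Suc[OF Gauss_suminf_tendsto_1])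
  \<comment> \<open>The exponents \<open>e + (e - b - c)\<close> and \<open>(e - b) + (e - c)\<close> agree, so the normalising
      factors of the four Gamma limits cancel.\<close>
  have "rGamma_series e k * rGamma_series (e - b - c) k * F =
      rGamma_series (e - b) k * rGamma_series (e - c) k * F' k" for k
  proof -
    define X where "X z = exp (z * of_real (ln (of_nat k)))" for z :: complex
    have X: "X e * X (e - b - c) = X (e - b) * X (e - c)"
      by (simp add: X_def algebra_simps flip: exp_add)
    have "rGamma_series e k * rGamma_series (e - b - c) k * F =
      (pochhammer e (Suc k) * pochhammer (e - b - c) (Suc k) * F) / (fact k ^ 2 * (X e * X (e - b - c)))"
      by (simp add: rGamma_series_def X_def power2_eq_square)
    also have "\<dots> = (pochhammer (e - b) (Suc k) * pochhammer (e - c) (Suc k) * F' k) / (fact k ^ 2 * (X (e - b) * X (e - c)))"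
      unfolding F_def F'_def Gauss_contiguous_iterated[OF assms] X ..
    also have "\<dots> = rGamma_series (e - b) k * rGamma_series (e - c) k * F' k"
      by (simp add: rGamma_series_def X_def power2_eq_square)
    finally show ?thesis .
  qed
  moreover have "(\<lambda>k. rGamma_series e k * rGamma_series (e - b - c) k * F) \<longlonglongrightarrow> rGamma e * rGamma (e - b - c) * F"
    by (intro tendsto_intros)
  moreover have "(\<lambda>k. rGamma_series (e - b) k * rGamma_series (e - c) k * F' k) \<longlonglongrightarrow> rGamma (e - b) * rGamma (e - c) * 1"
    by (intro tendsto_intros F')
  ultimately have eq: "rGamma e * rGamma (e - b - c) * F = rGamma (e - b) * rGamma (e - c)"
    using LIMSEQ_unique by fastforce
  have "e - b - c \<notin> \<int>\<^sub>\<le>\<^sub>0"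
    using assms(2) by (fastforce elim!: nonpos_Ints_cases dest: arg_cong[of _ _ Re])
  with assms(1) eq have "F = Gamma e * Gamma (e - b - c) * rGamma (e - b) * rGamma (e - c)"
    by (simp add: Gamma_def field_simps rGamma_eq_zero_iff)
  moreover have "Gauss_term b c e sums F"
    unfolding F_def using Gauss_term_summable[OF assms] summable_norm_cancel by blast
  ultimately show ?thesis
    using norm_summable_imp_has_sum[OF Gauss_term_summable[OF assms]] by simp
qed

lemma Gauss_summation_terminating:
  fixes b e :: complex
  assumes "e \<notin> \<int>\<^sub>\<le>\<^sub>0" "e - b + of_nat L \<notin> \<int>\<^sub>\<le>\<^sub>0"
  shows "(Gauss_term b (- of_nat L) e has_sum
          Gamma e * Gamma (e - b + of_nat L) * rGamma (e - b) * rGamma (e + of_nat L)) UNIV"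
proof (rule has_sum_finite_neutralI)
  show "Gauss_term b (- of_nat L) e n = 0" if "n \<in> UNIV - {..L}" for n
    using that by (simp add: Gauss_term_def pochhammer_of_nat_eq_0_iff)
  have "(\<Sum>n\<le>L. Gauss_term b (- of_nat L) e n) =
      (\<Sum>n\<le>L. of_nat (L choose n) * (-1) ^ n * pochhammer b n * pochhammer (e + of_nat n) (L - n)) / pochhammer e L"
    unfolding sum_divide_distrib
  proof (rule sum.cong[OF refl])
    fix n assume n: "n \<in> {..L}"
    then have "pochhammer e L = pochhammer e n * pochhammer (e + of_nat n) (L - n)"
      by (intro pochhammer_product) simp
    then show "Gauss_term b (- of_nat L) e n =
        of_nat (L choose n) * (-1) ^ n * pochhammer b n * pochhammer (e + of_nat n) (L - n) / pochhammer e L"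
      using pochhammer_nonzero[OF assms(1), of L]
      by (simp add: Gauss_term_def pochhammer_neg_of_nat)
  qed
  also have "\<dots> = (Gamma e * rGamma (e + of_nat L)) * (Gamma (e - b + of_nat L) * rGamma (e - b))"
    unfolding Chu_Vandermonde Gamma_mult_rGamma[OF assms(2)] Gamma_mult_rGamma'[OF assms(1)] by simp
  finally show "Gamma e * Gamma (e - b + of_nat L) * rGamma (e - b) * rGamma (e + of_nat L) =
      (\<Sum>n\<le>L. Gauss_term b (- of_nat L) e n)"
    by (simp add: mult_ac)
qed auto

text \<open>For a terminating series the Gamma evaluation needs no convergence condition, only that
  \<open>Gamma (e - b - c)\<close> is finite.\<close>

lemma Gauss_has_sum:
  fixes b c e :: complex
  assumes "e \<notin> \<int>\<^sub>\<le>\<^sub>0" "e - b - c \<notin> \<int>\<^sub>\<le>\<^sub>0" "c \<in> \<int>\<^sub>\<le>\<^sub>0 \<or> Re (e - b - c) > 0"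
  shows "(Gauss_term b c e has_sum Gamma e * Gamma (e - b - c) * rGamma (e - b) * rGamma (e - c)) UNIV"
proof (cases "c \<in> \<int>\<^sub>\<le>\<^sub>0")
  case True
  then obtain L where c: "c = - of_nat L" by (auto elim: nonpos_Ints_cases')
  show ?thesis
    using Gauss_summation_terminating[of e b L] assms(1,2) by (simp add: c)
next
  case False
  then show ?thesis using assms Gauss_summation by blast
qed

text \<open>The factor \<open>pochhammer (- of_nat n) k\<close> cancels part of $n!$ and kills the terms with $n<k$, so
  the substitution $n = l + k$ leads to a Gauss series with \<open>b, c, e\<close> all raised by \<open>k\<close>. The quotient
  $\Gamma(e-b-c-k)/\Gamma(e-b-c) = (-1)^k/(1+b+c-e)_k$ produces the new denominator parameter.\<close>

lemma Gauss_falling_has_sum: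
  fixes b c e :: complex
  assumes e: "e \<notin> \<int>\<^sub>\<le>\<^sub>0" and s: "e - b - c \<notin> \<int>" and conv: "c \<in> \<int>\<^sub>\<le>\<^sub>0 \<or> Re (e - b - c) > real k"
  shows "((\<lambda>n. Gauss_term b c e n * pochhammer (- of_nat n) k) has_sum
          Gamma e * Gamma (e - b - c) * rGamma (e - b) * rGamma (e - c) *
          (pochhammer b k * pochhammer c k / pochhammer (1 + b + c - e) k)) UNIV"
    (is "(?f has_sum ?S) UNIV")
proof (cases "pochhammer c k = 0")
  case True
  then have "Gauss_term b c e n * pochhammer (- of_nat n) k = 0" for n
    by (cases "k \<le> n") (auto simp: Gauss_term_def pochhammer_of_nat_eq_0_iff dest: pochhammer_eq_0_mono)
  then have "(?f has_sum 0) UNIV" by (intro has_sum_0)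
  then show ?thesis using True by simp
next
  case False
  define s where "s = e - b - c"
  have s': "s - of_nat k \<notin> \<int>" "s \<notin> \<int>" "1 - s \<notin> \<int>"
    using s Ints_add[of "s - of_nat k" "of_nat k"] Ints_diff[of 1 "1 - s"] by (auto simp: s_def)
  have reflect: "pochhammer (s - of_nat k) k = (-1) ^ k * pochhammer (1 - s) k"
    using pochhammer_minus[of "of_nat k - s" k] by simp
  have ek: "e + of_nat k \<notin> \<int>\<^sub>\<le>\<^sub>0" by (rule add_of_nat_notin_nonpos_Ints[OF e])
  have sh: "e + of_nat k - (b + of_nat k) - (c + of_nat k) = s - of_nat k"
    by (simp add: s_def)
  have conv': "c + of_nat k \<in> \<int>\<^sub>\<le>\<^sub>0 \<or> Re (s - of_nat k) > 0"
  proof (cases "c \<in> \<int>\<^sub>\<le>\<^sub>0")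
    case True
    then obtain L where c: "c = - of_nat L" by (auto elim: nonpos_Ints_cases')
    with False have "k \<le> L" by (simp add: pochhammer_of_nat_eq_0_iff)
    then have "c + of_nat k = - of_nat (L - k)" by (simp add: c of_nat_diff)
    then show ?thesis by simp
  qed (use conv in \<open>auto simp: s_def\<close>)
  define C where "C = (-1) ^ k * pochhammer b k * pochhammer c k / pochhammer e k"
  have nz: "pochhammer e k \<noteq> 0" "pochhammer (1 - s) k \<noteq> 0"
    using e s'(3) by (auto intro!: pochhammer_nonzero simp: not_in_Ints_imp_not_in_nonpos_Ints)
  have shifted: "?f (l + k) = C * Gauss_term (b + of_nat k) (c + of_nat k) (e + of_nat k) l" for l
  proof -
    have "pochhammer (- of_nat (l + k) :: complex) k = (-1) ^ k * fact (l + k) / fact l"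
      using pochhammer_neg_of_nat[of "l + k" k, where 'a = complex] by (simp add: binomial_fact del: of_nat_add)
    moreover have "pochhammer x (l + k) = pochhammer x k * pochhammer (x + of_nat k) l" for x :: complex
      by (metis add.commute pochhammer_product')
    ultimately show ?thesis
      by (simp add: Gauss_term_def C_def mult_ac)
  qed
  have "(Gauss_term (b + of_nat k) (c + of_nat k) (e + of_nat k) has_sum
      Gamma (e + of_nat k) * Gamma (s - of_nat k) * rGamma (e - b) * rGamma (e - c)) UNIV"
    using Gauss_has_sum[OF ek, of "b + of_nat k" "c + of_nat k"] conv' s'(1)
    unfolding sh by (simp add: not_in_Ints_imp_not_in_nonpos_Ints)
  from has_sum_cmult_right[OF this, of C]
  have "((\<lambda>l. ?f (l + k)) has_sum C * (Gamma (e + of_nat k) * Gamma (s - of_nat k) * rGamma (e - b) * rGamma (e - c))) UNIV"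
    by (simp only: shifted)
  also have "C * (Gamma (e + of_nat k) * Gamma (s - of_nat k) * rGamma (e - b) * rGamma (e - c)) = ?S"
  proof -
    have 1: "Gamma (e + of_nat k) = pochhammer e k * Gamma e"
      using pochhammer_Gamma[OF e, of k] e by (simp add: Gamma_eq_zero_iff)
    have 2: "Gamma s = (-1) ^ k * pochhammer (1 - s) k * Gamma (s - of_nat k)"
      using pochhammer_Gamma[of "s - of_nat k" k] s'(1) unfolding reflect
      by (simp add: Gamma_eq_zero_iff not_in_Ints_imp_not_in_nonpos_Ints)
    have 3: "1 + b + c - e = 1 - s" by (simp add: s_def)
    have "((-1) ^ k * (-1) ^ k :: complex) = 1" by (simp flip: power_mult_distrib)
    then show ?thesis
      unfolding 3 s_def[symmetric] 1 2 C_def using nz by (simp add: field_simps)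
  qed
  finally have "((\<lambda>l. ?f (l + k)) has_sum ?S) UNIV" .
  then have "(?f has_sum ?S) ((\<lambda>l. l + k) ` UNIV)"
    by (subst has_sum_reindex) (simp_all add: o_def)
  moreover have "?f n = 0" if "n \<notin> range (\<lambda>l. l + k)" for n
  proof -
    have "n < k" using that by (metis le_add_diff_inverse2 not_le rangeI)
    then show ?thesis by (simp add: pochhammer_of_nat_eq_0_iff)
  qed
  ultimately show ?thesis
    by (elim has_sum_cong_neutral[THEN iffD1, rotated 3]) auto
qed

section \<open>Summation of the double series\<close>

lemma has_sum_finite_sum:
  fixes f :: "'i \<Rightarrow> 'x \<Rightarrow> 'b::topological_comm_monoid_add"
  assumes "finite I" "\<And>i. i \<in> I \<Longrightarrow> (f i has_sum S i) X"
  shows "((\<lambda>x. \<Sum>i\<in>I. f i x) has_sum (\<Sum>i\<in>I. S i)) X"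
  using assms by (induction I rule: finite_induct) (auto intro!: has_sum_add has_sum_0)

text \<open>With finitely many rows it is enough that each row is summable on its own; the value can then be
  computed by summing the columns.\<close>

lemma finitely_many_rows_has_sum:
  fixes f :: "nat \<Rightarrow> nat \<Rightarrow> complex"
  assumes rows: "\<And>m. m \<le> R \<Longrightarrow> f m summable_on UNIV"
    and zero: "\<And>m n. m > R \<Longrightarrow> f m n = 0"
    and sum: "((\<lambda>n. \<Sum>m\<le>R. f m n) has_sum S) UNIV"
  shows "((\<lambda>(m, n). f m n) has_sum S) UNIV"
proof -
  define V where "V m = infsum (f m) UNIV" for m
  have V: "(f m has_sum V m) UNIV" if "m \<in> {..R}" for m
    using rows that by (simp add: V_def)
  have "((\<lambda>n. \<Sum>m\<le>R. f m n) has_sum (\<Sum>m\<le>R. V m)) UNIV"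
    by (rule has_sum_finite_sum[OF finite_atMost V])
  then have S: "S = (\<Sum>m\<le>R. V m)"
    using sum has_sum_unique by blast
  have "((\<lambda>(i, n). if i = m then f m n else 0) has_sum V m) UNIV" if m: "m \<in> {..R}" for m
  proof -
    have "((\<lambda>(i, n). f i n) has_sum V m) (Pair m ` UNIV)"
      using V[OF m] by (subst has_sum_reindex) (auto simp: o_def inj_on_def)
    then show ?thesis
      by (rule has_sum_cong_neutral[THEN iffD1, rotated 3]) auto
  qed
  then have "((\<lambda>x. \<Sum>m\<le>R. (\<lambda>(i, n). if i = m then f m n else 0) x) has_sum (\<Sum>m\<le>R. V m)) UNIV"
    by (intro has_sum_finite_sum) auto
  also have "(\<lambda>x. \<Sum>m\<le>R. (\<lambda>(i, n). if i = m then f m n else 0) x) = (\<lambda>(m, n). f m n)"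
    using zero by (auto simp: fun_eq_iff not_le)
  finally show ?thesis unfolding S .
qed

lemma hypergeo_terminating:
  assumes "pochhammer a (Suc K) = 0 \<or> pochhammer c (Suc K) = 0"
  shows "hypergeo [a, b, c, f] [g, h, i] 1 =
    (\<Sum>k\<le>K. pochhammer a k * pochhammer b k * pochhammer c k * pochhammer f k /
       (pochhammer g k * pochhammer h k * pochhammer i k * fact k))"
proof -
  have "pochhammer a k * pochhammer c k = 0" if "k > K" for k
    using assms that pochhammer_eq_0_mono[of _ "Suc K" k] by auto
  then show ?thesis
    unfolding hypergeo_def eval_fps_def
    by (subst suminf_finite[of "{..K}"]) (auto simp: not_le)
qed

text \<open>The quotient of rising factorials is a polynomial in \<open>n\<close> of degree \<open>N - m\<close>; written in the basis
  \<open>pochhammer (- of_nat n) k\<close> it leaves finitely many convergent Gauss sums.\<close>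

lemma rising_ratio_row_summable:
  fixes b c d e :: complex
  assumes "e \<notin> \<int>\<^sub>\<le>\<^sub>0" "e - b - c \<notin> \<int>" "Re (e - b - c) > real N" "d \<notin> \<int>\<^sub>\<le>\<^sub>0" "m \<le> N"
  shows "(\<lambda>n. pochhammer (d + of_nat N) n / pochhammer d (m + n) * Gauss_term b c e n) summable_on UNIV"
proof -
  define w where "w k = of_nat ((N - m) choose k) * (-1) ^ k * pochhammer (d + of_nat m + of_nat k) (N - m - k) / pochhammer d N" for k
  have "pochhammer (d + of_nat N) n / pochhammer d (m + n) = (\<Sum>k\<le>N - m. w k * pochhammer (- of_nat n) k)" for n
  proof -
    have "pochhammer d N * pochhammer (d + of_nat N) n = pochhammer d (m + n + (N - m))"
      using assms(5) by (simp add: add.commute flip: pochhammer_product')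
    also have "\<dots> = pochhammer d (m + n) * pochhammer (d + of_nat m - (- of_nat n)) (N - m)"
      by (subst pochhammer_product') (simp add: add_ac)
    finally have "pochhammer (d + of_nat N) n / pochhammer d (m + n) =
        pochhammer (d + of_nat m - (- of_nat n)) (N - m) / pochhammer d N"
      using pochhammer_nonzero[OF assms(4)] by (simp add: field_simps)
    also have "\<dots> = (\<Sum>k\<le>N - m. w k * pochhammer (- of_nat n) k)"
      unfolding Chu_Vandermonde[symmetric] sum_divide_distrib w_def
      by (intro sum.cong) simp_all
    finally show ?thesis .
  qed
  then have "(\<lambda>n. pochhammer (d + of_nat N) n / pochhammer d (m + n) * Gauss_term b c e n) =
      (\<lambda>n. \<Sum>k\<le>N - m. w k * (Gauss_term b c e n * pochhammer (- of_nat n) k))"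
    by (simp add: sum_distrib_right sum_distrib_left mult_ac)
  moreover have "(\<lambda>n. \<Sum>k\<le>N - m. w k * (Gauss_term b c e n * pochhammer (- of_nat n) k)) summable_on UNIV"
  proof -
    have "\<exists>S. ((\<lambda>n. w k * (Gauss_term b c e n * pochhammer (- of_nat n) k)) has_sum S) UNIV" if "k \<in> {..N - m}" for k
    proof -
      have "real k \<le> real N" using that by simp
      then show ?thesis
        using has_sum_cmult_right[OF Gauss_falling_has_sum[OF assms(1,2), of k]] assms(3) by fastforce
    qed
    then obtain S where "\<And>k. k \<in> {..N - m} \<Longrightarrow>
        ((\<lambda>n. w k * (Gauss_term b c e n * pochhammer (- of_nat n) k)) has_sum S k) UNIV"
      by metis
    from has_sum_finite_sum[OF finite_atMost this] show ?thesis
      by (rule has_sum_imp_summable)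
  qed
  ultimately show ?thesis by simp
qed

theorem mainTheorem2:
  fixes a b c d e a' b' c' e' :: complex
  assumes a': "a' = d - a"
    and balanced: "d + e - a - b - c = 1"
    and cases: "(a \<in> \<int>\<^sub>\<le>\<^sub>0 - {0} \<and> Re (d + e' - a' - b' - c') > 0) \<or>
                (c \<in> \<int>\<^sub>\<le>\<^sub>0 - {0} \<and> c' \<in> \<int>\<^sub>\<le>\<^sub>0 - {0})"
    and left_params: "d \<notin> \<int>\<^sub>\<le>\<^sub>0" "e \<notin> \<int>\<^sub>\<le>\<^sub>0" "e' \<notin> \<int>\<^sub>\<le>\<^sub>0"
    and right_params: "d - b \<notin> \<int>\<^sub>\<le>\<^sub>0" "d - c \<notin> \<int>\<^sub>\<le>\<^sub>0" "1 + b' + c' - e' \<notin> \<int>\<^sub>\<le>\<^sub>0"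
    and gamma_args: "e - a - b \<notin> \<int>\<^sub>\<le>\<^sub>0" "e - a - c \<notin> \<int>\<^sub>\<le>\<^sub>0" "e - b - c \<notin> \<int>\<^sub>\<le>\<^sub>0"
                    "e' - b' - c' \<notin> \<int>\<^sub>\<le>\<^sub>0"
  shows "kdf_term d a b c e a' b' c' e' 1 1 summable_on UNIV \<and>
         kdf d a b c e a' b' c' e' 1 1 =
           Gamma e * Gamma (e - a - b) * Gamma (e - a - c) * Gamma (e - b - c) *
           Gamma e' * Gamma (e' - b' - c') *
           (rGamma (e - a) * rGamma (e - b) * rGamma (e - c) * rGamma (e - a - b - c) *
            rGamma (e' - b') * rGamma (e' - c')) *
           hypergeo [a, b', c', d - b - c] [d - b, d - c, 1 + b' + c' - e'] 1"
proof -
  define P where "P = Gamma e * Gamma (e - a - b) * Gamma (e - a - c) * Gamma (e - b - c) *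
      (rGamma (e - a) * rGamma (e - b) * rGamma (e - c) * rGamma (e - a - b - c))"
  define G where "G = Gamma e' * Gamma (e' - b' - c') * rGamma (e' - b') * rGamma (e' - c')"
  define H where "H = hypergeo [a, b', c', d - b - c] [d - b, d - c, 1 + b' + c' - e'] 1"
  define u where "u = Gauss_term b' c' e'"
  define v where "v m = pochhammer a m * pochhammer b m * pochhammer c m / (pochhammer e m * fact m)" for m
  define t where "t m n = v m * (pochhammer (d - a) n / pochhammer d (m + n) * u n)" for m n
  have kdf_t: "kdf_term d a b c e a' b' c' e' 1 1 = (\<lambda>(m, n). t m n)"
    by (simp add: kdf_term_def t_def u_def v_def Gauss_term_def a' mult_ac)

  \<comment> \<open>Excluding poles of \<open>Gamma (e' - b' - c')\<close> and zeros of \<open>pochhammer (1 + b' + c' - e') k\<close>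
      together rules out every integer.\<close>
  have nonint: "e' - b' - c' \<notin> \<int>"
  proof
    assume "e' - b' - c' \<in> \<int>"
    then obtain i where i: "e' - b' - c' = of_int i" by (auto elim: Ints_cases)
    show False
    proof (cases "i \<le> 0")
      case True
      then show False using gamma_args(4) i by (auto simp: nonpos_Ints_def)
    next
      case False
      then have "of_int (1 - i) \<in> (\<int>\<^sub>\<le>\<^sub>0 :: complex set)"
        by (intro nonpos_Ints_of_int) simp
      moreover have "1 + b' + c' - e' = of_int (1 - i)" using i by (simp add: algebra_simps)
      ultimately show False using right_params(3) by metis
    qed
  qed

  \<comment> \<open>Both cases provide the same data: a bound \<open>R\<close> on the nonzero rows, the point \<open>K\<close> at which
      the right-hand series stops, and the row identity. In the first case \<open>R = K = N\<close> where \<open>a = - N\<close>;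
      in the second \<open>R = M\<close> and \<open>K = L\<close> where \<open>c = - M\<close> and \<open>c' = - L\<close>.\<close>
  obtain R K where
    inner: "\<And>n. u n \<noteq> 0 \<Longrightarrow> pochhammer (d - a) n / pochhammer d n * trunc_3F2 R a b c (d + of_nat n) e =
        P * trunc_3F2 K a (- of_nat n) (d - b - c) (d - b) (d - c)"
    and v_zero: "\<And>m. m > R \<Longrightarrow> v m = 0"
    and rows: "\<And>m. m \<le> R \<Longrightarrow> t m summable_on UNIV"
    and conv: "c' \<in> \<int>\<^sub>\<le>\<^sub>0 \<or> Re (e' - b' - c') > real K"
    and stops: "pochhammer a (Suc K) = 0 \<or> pochhammer c' (Suc K) = 0"
    using cases
  proof (elim disjE conjE)
    assume "a \<in> \<int>\<^sub>\<le>\<^sub>0 - {0}" and Re: "Re (d + e' - a' - b' - c') > 0"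
    then obtain N where a: "a = - of_nat N" by (auto elim: nonpos_Ints_cases')
    \<comment> \<open>This is what keeps the Gauss sums convergent up to order \<open>k = N\<close>.\<close>
    have Re': "Re (e' - b' - c') > real N"
      using Re by (simp add: a' a)
    show ?thesis
    proof (rule that[of N N])
      show "pochhammer (d - a) n / pochhammer d n * trunc_3F2 N a b c (d + of_nat n) e =
        P * trunc_3F2 N a (- of_nat n) (d - b - c) (d - b) (d - c)" for n
        unfolding P_def using Saalschuetz_Gamma_quotient[OF a balanced] gamma_args
          row_sum_terminating_left[OF a balanced, of n] left_params right_params by simp
      show "t m summable_on UNIV" if "m \<le> N" for m
        unfolding t_def u_def
        using rising_ratio_row_summable[OF left_params(3) nonint Re' left_params(1) that]
        by (intro summable_on_cmult_right) (simp add: a)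
    qed (use Re' in \<open>auto simp: v_def a pochhammer_of_nat_eq_0_iff\<close>)
  next
    assume "c \<in> \<int>\<^sub>\<le>\<^sub>0 - {0}" and c'_nonpos: "c' \<in> \<int>\<^sub>\<le>\<^sub>0 - {0}"
    then obtain M L where c: "c = - of_nat M" and c': "c' = - of_nat L"
      by (auto elim!: nonpos_Ints_cases')
    have u_zero: "u n = 0" if "n > L" for n
      using that by (simp add: u_def Gauss_term_def c' pochhammer_of_nat_eq_0_iff)
    have balanced': "d + e - c - a - b = 1" using balanced by (simp add: algebra_simps)
    have P: "P = (-1) ^ M * (pochhammer (d - a) M * pochhammer (d - b) M / (pochhammer d M * pochhammer e M))"
      unfolding P_def using Saalschuetz_Gamma_quotient[OF c balanced'] left_params gamma_args
      by (simp add: mult_ac diff_diff_eq add_ac)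
    show ?thesis
    proof (rule that[of M L])
      fix n assume "u n \<noteq> 0"
      then have n: "n \<le> L" using u_zero by (meson not_le)
      \<comment> \<open>\<open>row_sum_terminating_right\<close> truncates at \<open>n\<close>; the factor \<open>pochhammer (- of_nat n) k\<close> allows any larger bound.\<close>
      have "trunc_3F2 L a (- of_nat n) (d - b - c) (d - b) (d - c) =
            trunc_3F2 n a (- of_nat n) (d - b - c) (d - b) (d - c)"
        unfolding trunc_3F2_def using n
        by (intro sum.mono_neutral_right) (auto simp: pochhammer_of_nat_eq_0_iff)
      then show "pochhammer (d - a) n / pochhammer d n * trunc_3F2 M a b c (d + of_nat n) e =
        P * trunc_3F2 L a (- of_nat n) (d - b - c) (d - b) (d - c)"
        unfolding P using row_sum_terminating_right[OF c balanced, of n] left_params right_params by simp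
    next
      show "t m summable_on UNIV" for m
      proof -
        have "t m summable_on {..L}" by simp
        then show ?thesis
          by (rule summable_on_cong_neutral[THEN iffD1, rotated 3]) (auto simp: t_def u_zero)
      qed
    qed (use c'_nonpos in \<open>auto simp: v_def c c' pochhammer_of_nat_eq_0_iff\<close>)
  qed

  define w where "w k = pochhammer a k * pochhammer (d - b - c) k /
      (pochhammer (d - b) k * pochhammer (d - c) k * fact k)" for k
  have column: "(\<Sum>m\<le>R. t m n) = (\<Sum>k\<le>K. P * w k * (u n * pochhammer (- of_nat n) k))" for n
  proof (cases "u n = 0")
    case False
    have "(\<Sum>m\<le>R. t m n) = u n * (pochhammer (d - a) n / pochhammer d n * trunc_3F2 R a b c (d + of_nat n) e)"
      unfolding trunc_3F2_def sum_distrib_left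
    proof (rule sum.cong[OF refl])
      fix m
      have "pochhammer d (m + n) = pochhammer d n * pochhammer (d + of_nat n) m"
        by (metis add.commute pochhammer_product')
      then show "t m n = u n * (pochhammer (d - a) n / pochhammer d n * (pochhammer a m * pochhammer b m * pochhammer c m /
          (pochhammer (d + of_nat n) m * pochhammer e m * fact m)))"
        by (simp add: t_def v_def mult_ac)
    qed
    also have "\<dots> = (\<Sum>k\<le>K. P * w k * (u n * pochhammer (- of_nat n) k))"
      unfolding inner[OF False]
      by (simp add: trunc_3F2_def sum_distrib_left w_def mult_ac)
    finally show ?thesis .
  qed (simp add: t_def)

  have "((\<lambda>n. \<Sum>m\<le>R. t m n) has_sum
      (\<Sum>k\<le>K. P * w k * (G * (pochhammer b' k * pochhammer c' k / pochhammer (1 + b' + c' - e') k)))) UNIV"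
    unfolding column
  proof (intro has_sum_finite_sum has_sum_cmult_right finite_atMost)
    fix k assume k: "k \<in> {..K}"
    have conv_k: "c' \<in> \<int>\<^sub>\<le>\<^sub>0 \<or> Re (e' - b' - c') > real k"
      using conv k by auto
    show "((\<lambda>n. u n * pochhammer (- of_nat n) k) has_sum
        G * (pochhammer b' k * pochhammer c' k / pochhammer (1 + b' + c' - e') k)) UNIV"
      unfolding u_def G_def by (rule Gauss_falling_has_sum[OF left_params(3) nonint conv_k])
  qed
  also have "(\<Sum>k\<le>K. P * w k * (G * (pochhammer b' k * pochhammer c' k / pochhammer (1 + b' + c' - e') k))) = P * G * H"
    unfolding H_def hypergeo_terminating[OF stops] sum_distrib_left
    by (intro sum.cong) (simp_all add: w_def mult_ac)
  finally have columns: "((\<lambda>n. \<Sum>m\<le>R. t m n) has_sum P * G * H) UNIV" .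
  have t_zero: "t m n = 0" if "m > R" for m n
    using v_zero[OF that] by (simp add: t_def)
  have "((\<lambda>(m, n). t m n) has_sum P * G * H) UNIV"
    using rows t_zero columns by (rule finitely_many_rows_has_sum)
  then have "(kdf_term d a b c e a' b' c' e' 1 1 has_sum P * G * H) UNIV"
    by (simp only: kdf_t)
  then have "kdf_term d a b c e a' b' c' e' 1 1 summable_on UNIV" "kdf d a b c e a' b' c' e' 1 1 = P * G * H"
    by (auto simp: kdf_def dest: has_sum_imp_summable infsumI)
  then show ?thesis
    by (simp add: P_def G_def H_def mult_ac)
qed

end
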